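(* Let $L>0$, let $F:\mathbb{R}^d\to\mathbb{R}^d$ be monotone and $L$-Lipschitz, and let $x^*\in\mathbb{R}^d$ satisfy $F(x^* )=0$. Let $0<\gamma\le \frac{1}{\sqrt{2}L}$, let $x^0\in\mathbb{R}^d$, and let $x^{k+1}=x^k-\gamma F\left(x^k-\gamma F(x^k)\right)$ for $k\ge 0$. Then for all $K\ge 0$ $$\|F(x^K)\|^2\le \frac{\|x^0-x^*\|^2}{\gamma^2(1-L^2\gamma^2)(K+1)}$$ and $$\mathrm{Gap}_F(x^K)\le \frac{2\|x^0-x^*\|^2}{\gamma\sqrt{1-L^2\gamma^2}\,\sqrt{K+1}},$$ where $\mathrm{Gap}_F(x)=\max_{y\in\mathbb{R}^d:\ \|y-x^*\|\le\|x^0-x^*\|}\langle F(y),x-y\rangle$.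
   Context: $\langle\cdot,\cdot\rangle$ and $\|\cdot\|$ are the standard Euclidean inner product and norm. $F$ is monotone if $\langle F(x)-F(x'),x-x'\rangle\ge 0$ for all $x,x'\in\mathbb{R}^d$, and $L$-Lipschitz if $\|F(x)-F(x')\|\le L\|x-x'\|$ for all $x,x'\in\mathbb{R}^d$. The iteration in the claim is the Extragradient method. *)

theory Defs
  imports "HOL-Analysis.Analysis"
begin

definition monotone_operator :: "('a::real_inner \<Rightarrow> 'a) \<Rightarrow> bool" where
  "monotone_operator F \<longleftrightarrow> (\<forall>x x'. (F x - F x') \<bullet> (x - x') \<ge> 0)"

text \<open>
  The maximum over the closed ball of centre \<open>c\<close> and radius \<open>r\<close> is written as a supremum.
  It is attained whenever \<open>F\<close> is continuous, see \<open>gap_attained\<close>.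
\<close>

definition gap :: "('a::real_inner \<Rightarrow> 'a) \<Rightarrow> 'a \<Rightarrow> real \<Rightarrow> 'a \<Rightarrow> real" where
  "gap F c r x = (SUP y\<in>{y. norm (y - c) \<le> r}. F y \<bullet> (x - y))"

lemma gap_attained:
  fixes F :: "'a::euclidean_space \<Rightarrow> 'a"
  assumes cont: "continuous_on UNIV F" and r: "0 \<le> r"
  shows "\<exists>y. norm (y - c) \<le> r \<and> gap F c r x = F y \<bullet> (x - y) \<and>
             (\<forall>z. norm (z - c) \<le> r \<longrightarrow> F z \<bullet> (x - z) \<le> F y \<bullet> (x - y))"
proof -
  have B: "{y. norm (y - c) \<le> r} = cball c r"
    by (auto simp: dist_norm norm_minus_commute)
  have "continuous_on (cball c r) (\<lambda>y. F y \<bullet> (x - y))"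
    by (intro continuous_intros continuous_on_subset[OF cont]) auto
  then obtain y where y: "y \<in> cball c r"
    and max: "\<And>z. z \<in> cball c r \<Longrightarrow> F z \<bullet> (x - z) \<le> F y \<bullet> (x - y)"
    using continuous_attains_sup[of "cball c r" "\<lambda>y. F y \<bullet> (x - y)"] r by auto
  have "gap F c r x = F y \<bullet> (x - y)"
    unfolding gap_def B by (rule cSup_eq_maximum) (use y max in auto)
  then show ?thesis
    using y max B by blast
qed

end

theory Submission imports Defs
begin

text \<open>
  Let \<open>y = x - \<gamma> F x\<close> and \<open>x\<^sup>+ = x - \<gamma> F y\<close>. Monotonicity at \<open>(y, x\<^sup>*)\<close> and the Lipschitz bound at \<open>(x, y)\<close>
  make the squared distance to \<open>x\<^sup>*\<close> decrease by at least \<open>\<gamma>\<^sup>2 (1 - L\<^sup>2 \<gamma>\<^sup>2) \<parallel>F x\<parallel>\<^sup>2\<close>, while monotonicity at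
  \<open>(x, x\<^sup>+)\<close> and the Lipschitz bound at \<open>(y, x\<^sup>+)\<close> make \<open>\<parallel>F x\<parallel>\<close> nonincreasing. Summing the decrease
  bounds \<open>\<parallel>F (x K)\<parallel>\<close>, and the gap is at most \<open>\<langle>F (x K), x K - y\<rangle>\<close> by monotonicity,
  hence at most \<open>2 \<parallel>x 0 - x\<^sup>*\<parallel> \<parallel>F (x K)\<parallel>\<close>.
\<close>

lemma monotone_operatorD:
  "monotone_operator F \<Longrightarrow> 0 \<le> (F x - F y) \<bullet> (x - y)"
  by (simp add: monotone_operator_def)

text \<open>Points of one extragradient step differ by \<open>\<gamma>\<close> times a value of
  \<open>F\<close> or a difference of two; pulling out the scalar makes
  \<open>L\<^sup>2 * \<gamma>\<^sup>2\<close> appear.\<close>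

lemma lipschitz_on_norm_power2:
  fixes F :: "'a::real_inner \<Rightarrow> 'a"
  assumes "L-lipschitz_on UNIV F" and "x - y = c *\<^sub>R v"
  shows "(norm (F x - F y))\<^sup>2 \<le> L\<^sup>2 * c\<^sup>2 * (norm v)\<^sup>2"
proof -
  have "norm (F x - F y) \<le> L * norm (x - y)"
    using lipschitz_onD[OF assms(1), of x y] by (simp add: dist_norm)
  then have "(norm (F x - F y))\<^sup>2 \<le> (L * norm (x - y))\<^sup>2"
    by (intro power_mono) auto
  then show ?thesis
    by (simp add: assms(2) power_mult_distrib mult.assoc)
qed

lemma norm_extragradient_step_le:
  fixes F :: "'a::real_inner \<Rightarrow> 'a"
  assumes mono: "monotone_operator F" and lip: "L-lipschitz_on UNIV F"
    and pos: "0 < \<gamma>" and small: "L\<^sup>2 * \<gamma>\<^sup>2 \<le> 1"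
  shows "norm (F (x - \<gamma> *\<^sub>R F (x - \<gamma> *\<^sub>R F x))) \<le> norm (F x)"
proof -
  define f where "f = F x"
  define g where "g = F (x - \<gamma> *\<^sub>R f)"
  define h where "h = F (x - \<gamma> *\<^sub>R g)"
  have "0 \<le> (f - h) \<bullet> (\<gamma> *\<^sub>R g)"
    using monotone_operatorD[OF mono, of x "x - \<gamma> *\<^sub>R g"] by (simp add: f_def h_def)
  then have "0 \<le> (f - h) \<bullet> g"
    using pos by (simp add: zero_le_mult_iff)
  moreover have "(norm (g - h))\<^sup>2 \<le> (norm (g - f))\<^sup>2"
  proof -
    have "(norm (g - h))\<^sup>2 \<le> L\<^sup>2 * \<gamma>\<^sup>2 * (norm (g - f))\<^sup>2"
      using lipschitz_on_norm_power2[OF lip, of "x - \<gamma> *\<^sub>R f" "x - \<gamma> *\<^sub>R g" \<gamma> "g - f"]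
      by (simp add: scaleR_diff_right flip: g_def h_def)
    also have "\<dots> \<le> 1 * (norm (g - f))\<^sup>2"
      using small by (intro mult_right_mono) auto
    finally show ?thesis by simp
  qed
  \<comment> \<open>Expanding both squares cancels \<open>g \<bullet> g\<close> and leaves \<open>h
    \<bullet> h \<le> f \<bullet> f - 2 * ((f - h) \<bullet> g)\<close>.\<close>
  ultimately have "h \<bullet> h \<le> f \<bullet> f"
    by (simp add: power2_norm_eq_inner algebra_simps inner_commute)
  then show ?thesis
    by (simp add: norm_le f_def g_def h_def)
qed

lemma extragradient_step_distance:
  fixes F :: "'a::real_inner \<Rightarrow> 'a"
  assumes mono: "monotone_operator F" and lip: "L-lipschitz_on UNIV F"
    and zero: "F z = 0" and pos: "0 < \<gamma>"
  shows "(norm (x - \<gamma> *\<^sub>R F (x - \<gamma> *\<^sub>R F x) - z))\<^sup>2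
    \<le> (norm (x - z))\<^sup>2 - \<gamma>\<^sup>2 * (1 - L\<^sup>2 * \<gamma>\<^sup>2) * (norm (F x))\<^sup>2"
proof -
  define f where "f = F x"
  define g where "g = F (x - \<gamma> *\<^sub>R f)"
  have "0 \<le> g \<bullet> (x - \<gamma> *\<^sub>R f - z)"
    using monotone_operatorD[OF mono, of "x - \<gamma> *\<^sub>R f" z] by (simp add: g_def zero)
  then have mono_g: "\<gamma> * (\<gamma> * (g \<bullet> f)) \<le> \<gamma> * (g \<bullet> (x - z))"
    using pos by (intro mult_left_mono) (simp_all add: algebra_simps)
  have "(norm (f - g))\<^sup>2 \<le> L\<^sup>2 * \<gamma>\<^sup>2 * (norm f)\<^sup>2"
    using lipschitz_on_norm_power2[OF lip, of x "x - \<gamma> *\<^sub>R f" \<gamma> f]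
    by (simp add: f_def g_def)
  then have lip_g: "\<gamma>\<^sup>2 * (norm (f - g))\<^sup>2 \<le> \<gamma>\<^sup>2 * (L\<^sup>2 * \<gamma>\<^sup>2 * (norm f)\<^sup>2)"
    by (intro mult_left_mono) auto
  have "(norm (x - \<gamma> *\<^sub>R g - z))\<^sup>2
      = (norm ((x - z) - \<gamma> *\<^sub>R g))\<^sup>2"
    by (simp add: algebra_simps)
  also have "\<dots> = (norm (x - z))\<^sup>2 - 2 * (\<gamma> * (g \<bullet> (x - z))) + \<gamma>\<^sup>2 * (g \<bullet> g)"
    \<comment> \<open>The instantiated rules split only the outer difference, so
      \<open>x - z\<close> stays whole and \<open>g \<bullet> (x - z)\<close> matches
      \<open>mono_g\<close>.\<close>
    unfolding power2_norm_eq_inner inner_diff_left[of "x - z" "\<gamma> *\<^sub>R g"]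
      inner_diff_right[of _ "x - z" "\<gamma> *\<^sub>R g"]
    by (simp add: inner_commute[of "x - z" g] power2_eq_square)
  also have "\<dots> \<le> (norm (x - z))\<^sup>2 - 2 * (\<gamma> * (\<gamma> * (g \<bullet> f))) + \<gamma>\<^sup>2 * (g \<bullet> g)"
    using mono_g by linarith
  \<comment> \<open>Completing the square: \<open>g \<bullet> g - 2 * (g \<bullet> f)\<close> is the
    squared norm of \<open>f - g\<close> minus that of \<open>f\<close>.\<close>
  also have "\<dots> = (norm (x - z))\<^sup>2 - \<gamma>\<^sup>2 * (norm f)\<^sup>2 + \<gamma>\<^sup>2 * (norm (f - g))\<^sup>2"
    unfolding power2_norm_eq_inner
    by (simp add: algebra_simps inner_commute power2_eq_square)
  also have "\<dots> \<le> (norm (x - z))\<^sup>2 - \<gamma>\<^sup>2 * (1 - L\<^sup>2 * \<gamma>\<^sup>2) * (norm f)\<^sup>2"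
    using lip_g by (simp add: algebra_simps)
  finally show ?thesis
    by (simp add: f_def g_def)
qed

text \<open>Monotonicity trades the varying \<open>F y\<close> for the fixed \<open>F x\<close>; the
  factor \<open>2 * r\<close> is the diameter of the ball, which contains both \<open>x\<close> and
  \<open>y\<close>.\<close>

lemma gap_le:
  fixes F :: "'a::real_inner \<Rightarrow> 'a"
  assumes mono: "monotone_operator F" and x: "norm (x - c) \<le> r"
  shows "gap F c r x \<le> 2 * r * norm (F x)"
  unfolding gap_def
proof (rule cSUP_least)
  have "0 \<le> r"
    using x norm_ge_zero order_trans by blast
  then show "{y. norm (y - c) \<le> r} \<noteq> {}"
    by (auto intro: exI[of _ c])
next
  fix y assume "y \<in> {y. norm (y - c) \<le> r}"
  then have "norm (x - y) \<le> 2 * r"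
    using x norm_triangle_ineq4[of "x - c" "y - c"] by simp
  then have "norm (F x) * norm (x - y) \<le> norm (F x) * (2 * r)"
    by (intro mult_left_mono) auto
  moreover have "F y \<bullet> (x - y) \<le> F x \<bullet> (x - y)"
    using monotone_operatorD[OF mono, of x y] by (simp add: inner_diff_left)
  ultimately show "F y \<bullet> (x - y) \<le> 2 * r * norm (F x)"
    using norm_cauchy_schwarz[of "F x" "x - y"] by (simp add: mult_ac)
qed

theorem theorem3p3:
  fixes F :: "real ^ 'd \<Rightarrow> real ^ 'd"
    and x :: "nat \<Rightarrow> real ^ 'd"
    and xstar :: "real ^ 'd"
    and L \<gamma> :: real
  assumes "L > 0"
    and "monotone_operator F"
    and "L-lipschitz_on UNIV F"
    and "F xstar = 0"
    and "0 < \<gamma>" and "\<gamma> \<le> 1 / (sqrt 2 * L)"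
    and "\<And>k. x (Suc k) = x k - \<gamma> *\<^sub>R F (x k - \<gamma> *\<^sub>R F (x k))"
  shows "\<forall>K::nat.
    (norm (F (x K)))\<^sup>2
      \<le> (norm (x 0 - xstar))\<^sup>2 / (\<gamma>\<^sup>2 * (1 - L\<^sup>2 * \<gamma>\<^sup>2) * (real K + 1)) \<and>
    gap F xstar (norm (x 0 - xstar)) (x K)
      \<le> 2 * (norm (x 0 - xstar))\<^sup>2
          / (\<gamma> * sqrt (1 - L\<^sup>2 * \<gamma>\<^sup>2) * sqrt (real K + 1))"
proof
  fix K :: nat
  define R where "R = norm (x 0 - xstar)"
  define q where "q = 1 - L\<^sup>2 * \<gamma>\<^sup>2"
  \<comment> \<open>Squaring the step-size bound gives 1/2, which serves both the decrease of the
    residual norm and the positivity of \<open>q\<close>.\<close>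
  have "L * \<gamma> \<le> 1 / sqrt 2"
    using assms(1,6) by (simp add: field_simps)
  then have "(L * \<gamma>)\<^sup>2 \<le> (1 / sqrt 2)\<^sup>2"
    using assms(1,5) by (intro power_mono) auto
  then have a: "L\<^sup>2 * \<gamma>\<^sup>2 \<le> 1 / 2"
    by (simp add: power_mult_distrib power_divide)
  then have q: "0 < q" by (simp add: q_def)
  have "norm (F (x (Suc k))) \<le> norm (F (x k))" for k
    using norm_extragradient_step_le[OF assms(2,3,5), of "x k"] a by (simp add: assms(7))
  then have dec: "norm (F (x K)) \<le> norm (F (x k))" if "k \<le> K" for k
    using that by (rule lift_Suc_antimono_le)
  have step: "(norm (x (Suc k) - xstar))\<^sup>2
      \<le> (norm (x k - xstar))\<^sup>2 - \<gamma>\<^sup>2 * q * (norm (F (x k)))\<^sup>2" for k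
    using extragradient_step_distance[OF assms(2-5), of "x k"] by (simp add: assms(7) q_def)
  \<comment> \<open>Telescoping \<open>step\<close>. The distance term is kept on the left: it
    yields \<open>dist\<close>, while the sum yields \<open>F_le\<close>.\<close>
  have sum: "(norm (x n - xstar))\<^sup>2 + \<gamma>\<^sup>2 * q * (\<Sum>k<n. (norm (F (x k)))\<^sup>2) \<le> R\<^sup>2" for n
  proof (induction n)
    case (Suc n)
    then show ?case
      using step[of n] by (simp add: distrib_left)
  qed (simp add: R_def)
  have dist: "norm (x K - xstar) \<le> R"
  proof (rule power2_le_imp_le)
    have "0 \<le> \<gamma>\<^sup>2 * q * (\<Sum>k<K. (norm (F (x k)))\<^sup>2)"
      using q by (intro mult_nonneg_nonneg sum_nonneg) auto
    then show "(norm (x K - xstar))\<^sup>2 \<le> R\<^sup>2"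
      using sum[of K] by linarith
  qed (simp add: R_def)
  \<comment> \<open>By \<open>dec\<close> the residual at \<open>K\<close> is the smallest of the
    \<open>K + 1\<close> summands, so the bound on the sum becomes a last-iterate bound.\<close>
  have "(\<Sum>k<Suc K. (norm (F (x K)))\<^sup>2) \<le> (\<Sum>k<Suc K. (norm (F (x k)))\<^sup>2)"
    by (intro sum_mono power_mono dec) auto
  then have "\<gamma>\<^sup>2 * q * ((real K + 1) * (norm (F (x K)))\<^sup>2)
      \<le> \<gamma>\<^sup>2 * q * (\<Sum>k<Suc K. (norm (F (x k)))\<^sup>2)"
    using q by (intro mult_left_mono) (auto simp: algebra_simps)
  also have "\<dots> \<le> R\<^sup>2"
    using sum[of "Suc K"] zero_le_power2[of "norm (x (Suc K) - xstar)"] by linarith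
  finally have F_le: "(norm (F (x K)))\<^sup>2 \<le> R\<^sup>2 / (\<gamma>\<^sup>2 * q * (real K + 1))"
    using q assms(5) by (simp add: pos_le_divide_eq mult_ac)
  then have "norm (F (x K)) \<le> sqrt (R\<^sup>2 / (\<gamma>\<^sup>2 * q * (real K + 1)))"
    by (rule real_le_rsqrt)
  also have "\<dots> = R / (\<gamma> * sqrt q * sqrt (real K + 1))"
    using assms(5) by (simp add: real_sqrt_divide real_sqrt_mult R_def)
  finally have "2 * R * norm (F (x K)) \<le> 2 * R * (R / (\<gamma> * sqrt q * sqrt (real K + 1)))"
    by (intro mult_left_mono) (simp_all add: R_def)
  then have "gap F xstar R (x K) \<le> 2 * R\<^sup>2 / (\<gamma> * sqrt q * sqrt (real K + 1))"
    using gap_le[OF assms(2) dist] by (simp add: power2_eq_square)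
  with F_le show "(norm (F (x K)))\<^sup>2
      \<le> (norm (x 0 - xstar))\<^sup>2 / (\<gamma>\<^sup>2 * (1 - L\<^sup>2 * \<gamma>\<^sup>2) * (real K + 1)) \<and>
    gap F xstar (norm (x 0 - xstar)) (x K)
      \<le> 2 * (norm (x 0 - xstar))\<^sup>2
          / (\<gamma> * sqrt (1 - L\<^sup>2 * \<gamma>\<^sup>2) * sqrt (real K + 1))"
    by (simp add: R_def q_def)
qed

end
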